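(* Let $\gamma>0$, $\varepsilon>0$, $\bar\lambda\in\mathbb{R}_{\ge0}^{I_1\times I_2\times\cdots\times I_N}$ and $\mathcal{Z}\in\mathbb{R}^{I_1\times I_2\times\cdots\times I_N}$. The tensor MLCP $$f_{L,\gamma,\bar\lambda}(\mathcal{Z})=\sum_{i_1=1}^{I_1}\cdots\sum_{i_N=1}^{I_N} f_{L,\gamma,\bar\lambda_{i_1,\dots,i_N}}(\mathcal{Z}_{i_1,\dots,i_N})$$ is the optimal value of the optimization problem $$f_{L,\gamma,\bar\lambda}(\mathcal{Z})=\min_{\mathcal{W}\in\mathbb{R}_{\ge0}^{I_1\times\cdots\times I_N}}\left\{\|\mathcal{Z}\|_{L,\mathcal{W}}+\frac{\gamma}{2}\|\mathcal{W}-\bar\lambda\|_{F}^{2}\right\},$$ where $$\|\mathcal{Z}\|_{L,\mathcal{W}}=\sum_{i_1=1}^{I_1}\cdots\sum_{i_N=1}^{I_N}\mathcal{W}_{i_1,\dots,i_N}\log\left(\frac{|\mathcal{Z}_{i_1,\dots,i_N}|}{\varepsilon}+1\right)$$ and $\mathcal{W}$ is the weight tensor.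
   Context: For scalars $\lambda\ge 0$, $\gamma>0$, $\varepsilon>0$, the (scalar) MLCP function is $$f_{L,\gamma,\lambda}(z)=\begin{cases}\lambda\log\left(\frac{|z|}{\varepsilon}+1\right)-\frac{1}{2\gamma}\log^{2}\left(\frac{|z|}{\varepsilon}+1\right), & |z|\le \varepsilon e^{\gamma\lambda}-\varepsilon,\\[2pt] \frac{\gamma\lambda^{2}}{2}, & |z|>\varepsilon e^{\gamma\lambda}-\varepsilon.\end{cases}$$ The Frobenius norm of a tensor is the square root of the sum of squares of its entries. *)

theory Defs
  imports "HOL-Analysis.Analysis"
begin

(* A tensor of order N with dimensions I 1, ..., I N is a real function on the multi-indices
   (i_1, ..., i_N) with 1 <= i_n <= I n. Extensionality makes equality of functions the same as
   entrywise equality of tensors. *)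

definition tensor_idx :: "nat \<Rightarrow> (nat \<Rightarrow> nat) \<Rightarrow> (nat \<Rightarrow> nat) set" where
  "tensor_idx N I = (\<Pi>\<^sub>E n\<in>{1..N}. {1..I n})"

definition tensors :: "nat \<Rightarrow> (nat \<Rightarrow> nat) \<Rightarrow> ((nat \<Rightarrow> nat) \<Rightarrow> real) set" where
  "tensors N I = tensor_idx N I \<rightarrow>\<^sub>E UNIV"

definition nonneg_tensors :: "nat \<Rightarrow> (nat \<Rightarrow> nat) \<Rightarrow> ((nat \<Rightarrow> nat) \<Rightarrow> real) set" where
  "nonneg_tensors N I = tensor_idx N I \<rightarrow>\<^sub>E {0..}"

definition tensor_diff ::
  "nat \<Rightarrow> (nat \<Rightarrow> nat) \<Rightarrow> ((nat \<Rightarrow> nat) \<Rightarrow> real) \<Rightarrow> ((nat \<Rightarrow> nat) \<Rightarrow> real) \<Rightarrow> (nat \<Rightarrow> nat) \<Rightarrow> real" where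
  "tensor_diff N I A B = (\<lambda>i\<in>tensor_idx N I. A i - B i)"

definition frobenius_norm :: "nat \<Rightarrow> (nat \<Rightarrow> nat) \<Rightarrow> ((nat \<Rightarrow> nat) \<Rightarrow> real) \<Rightarrow> real" where
  "frobenius_norm N I A = sqrt (\<Sum>i\<in>tensor_idx N I. (A i)\<^sup>2)"

definition mlcp :: "real \<Rightarrow> real \<Rightarrow> real \<Rightarrow> real \<Rightarrow> real" where
  "mlcp \<epsilon> \<gamma> l z =
    (if \<bar>z\<bar> \<le> \<epsilon> * exp (\<gamma> * l) - \<epsilon>
     then l * ln (\<bar>z\<bar> / \<epsilon> + 1) - 1 / (2 * \<gamma>) * (ln (\<bar>z\<bar> / \<epsilon> + 1))\<^sup>2
     else \<gamma> * l\<^sup>2 / 2)"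

definition tensor_mlcp ::
  "nat \<Rightarrow> (nat \<Rightarrow> nat) \<Rightarrow> real \<Rightarrow> real \<Rightarrow> ((nat \<Rightarrow> nat) \<Rightarrow> real) \<Rightarrow> ((nat \<Rightarrow> nat) \<Rightarrow> real) \<Rightarrow> real" where
  "tensor_mlcp N I \<epsilon> \<gamma> L Z = (\<Sum>i\<in>tensor_idx N I. mlcp \<epsilon> \<gamma> (L i) (Z i))"

definition weighted_log_norm ::
  "nat \<Rightarrow> (nat \<Rightarrow> nat) \<Rightarrow> real \<Rightarrow> ((nat \<Rightarrow> nat) \<Rightarrow> real) \<Rightarrow> ((nat \<Rightarrow> nat) \<Rightarrow> real) \<Rightarrow> real" where
  "weighted_log_norm N I \<epsilon> W Z = (\<Sum>i\<in>tensor_idx N I. W i * ln (\<bar>Z i\<bar> / \<epsilon> + 1))"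

end

theory Submission
  imports Defs
begin

text \<open>
  The objective separates over the entries. With \<open>t = ln (\<bar>z\<bar> / \<epsilon> + 1)\<close>, each entry asks for the
  minimum over \<open>w \<ge> 0\<close> of the parabola \<open>w * t + \<gamma> / 2 * (w - l)\<^sup>2\<close>, whose unconstrained vertex is
  \<open>l - t / \<gamma>\<close>. The two branches of the MLCP function are the cases in which this vertex is
  nonnegative or is clipped to \<open>0\<close>.
\<close>

text \<open>Since \<open>exp\<close> is increasing, the threshold on \<bar>z\<bar> is one on the
  logarithm t. For \<gamma> > 0 it says exactly that the vertex l - t / \<gamma> is
  nonnegative.\<close>

lemma mlcp_eq_if_ln:
  assumes "\<epsilon> > 0"
  shows "mlcp \<epsilon> \<gamma> l z =
    (if ln (\<bar>z\<bar> / \<epsilon> + 1) \<le> \<gamma> * l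
     then l * ln (\<bar>z\<bar> / \<epsilon> + 1) - 1 / (2 * \<gamma>) * (ln (\<bar>z\<bar> / \<epsilon> + 1))\<^sup>2
     else \<gamma> * l\<^sup>2 / 2)"
proof -
  have "\<bar>z\<bar> / \<epsilon> + 1 > 0"
    using assms by (simp add: add_nonneg_pos)
  then have "ln (\<bar>z\<bar> / \<epsilon> + 1) \<le> \<gamma> * l \<longleftrightarrow> \<bar>z\<bar> / \<epsilon> + 1 \<le> exp (\<gamma> * l)"
    by (metis exp_le_cancel_iff exp_ln)
  also have "\<dots> \<longleftrightarrow> \<bar>z\<bar> \<le> \<epsilon> * exp (\<gamma> * l) - \<epsilon>"
    using assms by (simp add: field_simps)
  finally show ?thesis
    by (simp add: mlcp_def)
qed

lemma mlcp_le:
  assumes "\<gamma> > 0" "\<epsilon> > 0" "w \<ge> 0"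
  shows "mlcp \<epsilon> \<gamma> l z \<le> w * ln (\<bar>z\<bar> / \<epsilon> + 1) + \<gamma> / 2 * (w - l)\<^sup>2"
proof -
  define t where "t = ln (\<bar>z\<bar> / \<epsilon> + 1)"
  show ?thesis
  proof (cases "t \<le> \<gamma> * l")
    case True
    \<comment> \<open>Completing the square: the gap to the first branch is a multiple of the
      squared distance from w to the vertex.\<close>
    have "w * t + \<gamma> / 2 * (w - l)\<^sup>2 - (l * t - 1 / (2 * \<gamma>) * t\<^sup>2) = \<gamma> / 2 * (w - (l - t / \<gamma>))\<^sup>2"
      using assms(1) by (simp add: field_simps power2_eq_square)
    also have "\<dots> \<ge> 0"
      using assms(1) by simp
    finally show ?thesis
      using True assms(2) by (simp add: mlcp_eq_if_ln t_def)
  next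
    case False
    then have "w * (\<gamma> * l) \<le> w * t"
      using assms(3) by (intro mult_left_mono) auto
    moreover have "w * (\<gamma> * l) + \<gamma> / 2 * (w - l)\<^sup>2 = \<gamma> * l\<^sup>2 / 2 + \<gamma> / 2 * w\<^sup>2"
      by (simp add: field_simps power2_eq_square)
    moreover have "\<gamma> / 2 * w\<^sup>2 \<ge> 0"
      using assms(1) by simp
    ultimately show ?thesis
      using False assms(2) by (simp add: mlcp_eq_if_ln flip: t_def)
  qed
qed

text \<open>The bound of \<open>mlcp_le\<close> is attained at the vertex clipped to 0.\<close>

lemma mlcp_eq_max:
  fixes \<gamma> \<epsilon> l z :: real
  assumes "\<gamma> > 0" "\<epsilon> > 0"
  defines "w \<equiv> max 0 (l - ln (\<bar>z\<bar> / \<epsilon> + 1) / \<gamma>)"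
  shows "mlcp \<epsilon> \<gamma> l z = w * ln (\<bar>z\<bar> / \<epsilon> + 1) + \<gamma> / 2 * (w - l)\<^sup>2"
proof -
  define t where "t = ln (\<bar>z\<bar> / \<epsilon> + 1)"
  \<comment> \<open>Splitting \<open>max\<close> by the condition of \<open>mlcp_eq_if_ln\<close>
    aligns the branches, so each becomes a polynomial identity in t / \<gamma>, l and
    \<gamma>.\<close>
  have w: "w = (if t \<le> \<gamma> * l then l - t / \<gamma> else 0)"
    using assms(1) by (auto simp: w_def t_def max_def field_simps)
  show ?thesis
    unfolding w mlcp_eq_if_ln[OF assms(2)] t_def[symmetric]
    using assms(1) by (simp add: field_simps power2_eq_square)
qed

lemma objective_eq_sum:
  "weighted_log_norm N I \<epsilon> W Z + \<gamma> / 2 * (frobenius_norm N I (tensor_diff N I W L))\<^sup>2 =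
    (\<Sum>i\<in>tensor_idx N I. W i * ln (\<bar>Z i\<bar> / \<epsilon> + 1) + \<gamma> / 2 * (W i - L i)\<^sup>2)"
  by (simp add: weighted_log_norm_def frobenius_norm_def tensor_diff_def sum_nonneg
      sum.distrib sum_distrib_left)

theorem theorem5:
  fixes N :: nat and I :: "nat \<Rightarrow> nat"
    and \<gamma> \<epsilon> :: real
    and L Z :: "(nat \<Rightarrow> nat) \<Rightarrow> real"
  assumes "\<gamma> > 0" and "\<epsilon> > 0"
    and "L \<in> nonneg_tensors N I"
    and "Z \<in> tensors N I"
  shows "\<exists>W. is_arg_min
            (\<lambda>W. weighted_log_norm N I \<epsilon> W Z + \<gamma> / 2 * (frobenius_norm N I (tensor_diff N I W L))\<^sup>2)
            (\<lambda>W. W \<in> nonneg_tensors N I) W \<and>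
          tensor_mlcp N I \<epsilon> \<gamma> L Z =
            weighted_log_norm N I \<epsilon> W Z + \<gamma> / 2 * (frobenius_norm N I (tensor_diff N I W L))\<^sup>2"
proof -
  \<comment> \<open>No constraint couples the entries, so the scalar minimizers assemble into a
    global one; the restricted lambda keeps it extensional.\<close>
  define W where "W = (\<lambda>i\<in>tensor_idx N I. max 0 (L i - ln (\<bar>Z i\<bar> / \<epsilon> + 1) / \<gamma>))"
  have "W \<in> nonneg_tensors N I"
    by (auto simp: W_def nonneg_tensors_def)
  moreover have "tensor_mlcp N I \<epsilon> \<gamma> L Z =
      (\<Sum>i\<in>tensor_idx N I. W i * ln (\<bar>Z i\<bar> / \<epsilon> + 1) + \<gamma> / 2 * (W i - L i)\<^sup>2)"
    unfolding tensor_mlcp_def by (intro sum.cong refl) (simp add: W_def mlcp_eq_max assms(1,2))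
  moreover have "tensor_mlcp N I \<epsilon> \<gamma> L Z \<le>
      (\<Sum>i\<in>tensor_idx N I. V i * ln (\<bar>Z i\<bar> / \<epsilon> + 1) + \<gamma> / 2 * (V i - L i)\<^sup>2)"
    if "V \<in> nonneg_tensors N I" for V
    unfolding tensor_mlcp_def
    using that by (intro sum_mono mlcp_le assms(1,2)) (auto simp: nonneg_tensors_def)
  ultimately show ?thesis
    unfolding objective_eq_sum is_arg_min_linorder by (intro exI[of _ W]) auto
qed

end
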